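(* Let $N>4$ and $x,y>0$. In the model described in the context, let $s=(n_0\times s^{neg},\,n_1\times s^{pos},\,\bar n\times\bar s,\,n_l\times s^{lie})$ be a strategy profile with $n_0,n_1\in\{0,1\}$, $\bar n\notin\{N-1,N\}$ and $n_0+n_1+\bar n+n_l=N$, where $n_0$ agents always report $0$, $n_1$ agents always report $1$, $\bar n$ agents report honestly and $n_l$ agents always lie. If $(\bar n\neq0$ and $n_l\neq 0)$ or $(n_0=1$ and $n_1=1)$, then $s$ is not a Nash equilibrium of the payment mechanism $$\tau(0,0)=\varepsilon,\quad \tau(0,1)=x,\quad \tau(0,n)=0\ \text{ for } 2\le n\le N-1,$$ $$\tau(1,N-1)=\varepsilon,\quad \tau(1,N-2)=y,\quad \tau(1,n)=0\ \text{ for } 0\le n\le N-3,$$ for all sufficiently small $\varepsilon>0$ (how small may depend on $N$, $x$, $y$ and the probabilities of the model).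
   Context: $\Theta$ is a finite set of types with at least two elements. The prior satisfies $\Pr[\theta]>0$ for all $\theta\in\Theta$ and $\sum_\theta\Pr[\theta]=1$; each type $\theta$ has a probability $p_\theta=\Pr[\text{signal }1\mid\theta]\in(0,1)$, with $p_{\theta_1}\ne p_{\theta_2}$ whenever $\theta_1\ne\theta_2$. There are $N$ agents whose binary signals are, conditionally on the type $\theta$, independent and equal to $1$ with probability $p_\theta$ (and to $0$ otherwise). A pure reporting strategy is a map from the observed signal to the report, both in $\{0,1\}$: honest $\bar s(o)=o$; lying $s^{lie}(o)=1-o$; $s^{pos}(o)=1$; $s^{neg}(o)=0$. A payment mechanism consists of reals $\tau(r,n)$, $r\in\{0,1\}$, $n\in\{0,\dots,N-1\}$: the amount paid to an agent who reports $r$ when exactly $n$ of the other $N-1$ agents report $1$. A profile $(s_i)_{i=1}^N$ is a Nash equilibrium if for every agent $i$ and every observation $o\in\{0,1\}$, the conditional expected payment to $i$, given that $i$ observed $o$ (which updates the distribution of $\theta$ by Bayes' law) and that the other agents report according to their strategies $s_j$ ($j\ne i$), is at least as large when $i$ reports $s_i(o)$ as when $i$ reports $1-s_i(o)$. *)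

theory Defs
  imports "HOL-Probability.Probability" "HOL-Probability.Product_PMF"
begin

text \<open>Signals and reports are booleans: \<^term>\<open>True\<close> is 1 and \<^term>\<open>False\<close> is 0.
  The agents are the natural numbers below \<open>N\<close>.\<close>

type_synonym strategy = "bool \<Rightarrow> bool"

definition s_honest :: strategy where "s_honest = (\<lambda>sig. sig)"
definition s_lie :: strategy where "s_lie = (\<lambda>sig. \<not> sig)"
definition s_pos :: strategy where "s_pos = (\<lambda>_. True)"
definition s_neg :: strategy where "s_neg = (\<lambda>_. False)"

text \<open>Joint distribution of the type and the signal vector. The value \<^term>\<open>False\<close>
  given to \<^const>\<open>Pi_pmf\<close> is the dummy value of the coordinates outside \<open>{..<N}\<close>, and
  \<^term>\<open>p \<theta>\<close> is meant to lie in the unit interval for every \<open>\<theta>\<close> in the support of the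
  prior.\<close>

definition type_signal_pmf ::
    "nat \<Rightarrow> 'a pmf \<Rightarrow> ('a \<Rightarrow> real) \<Rightarrow> ('a \<times> (nat \<Rightarrow> bool)) pmf" where
  "type_signal_pmf N prior p =
     do {
       \<theta> \<leftarrow> prior;
       \<sigma> \<leftarrow> Pi_pmf {..<N} False (\<lambda>_. bernoulli_pmf (p \<theta>));
       return_pmf (\<theta>, \<sigma>)
     }"

text \<open>A payment mechanism \<open>\<tau>\<close> pays \<open>\<tau> r n\<close> to an agent who reports \<open>r\<close> when exactly
  \<open>n\<close> of the other agents report 1; its values for \<open>n \<ge> N\<close> are never used.\<close>

type_synonym payment = "bool \<Rightarrow> nat \<Rightarrow> real"

definition positive_reports_of_others ::
    "nat \<Rightarrow> (nat \<Rightarrow> strategy) \<Rightarrow> nat \<Rightarrow> (nat \<Rightarrow> bool) \<Rightarrow> nat" where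
  "positive_reports_of_others N s i \<sigma> = card {j. j < N \<and> j \<noteq> i \<and> s j (\<sigma> j)}"

text \<open>Conditional expected payment to agent \<open>i\<close> for the report \<open>r\<close>, given that \<open>i\<close>
  observed \<open>sig\<close>. Only the strategies of the other agents matter.\<close>

definition expected_payment ::
    "nat \<Rightarrow> 'a pmf \<Rightarrow> ('a \<Rightarrow> real) \<Rightarrow> payment \<Rightarrow> (nat \<Rightarrow> strategy) \<Rightarrow> nat \<Rightarrow> bool \<Rightarrow> bool \<Rightarrow> real"
  where
  "expected_payment N prior p \<tau> s i sig r =
     measure_pmf.expectation
       (cond_pmf (type_signal_pmf N prior p) {(\<theta>, \<sigma>). \<sigma> i = sig})
       (\<lambda>(\<theta>, \<sigma>). \<tau> r (positive_reports_of_others N s i \<sigma>))"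

definition nash_equilibrium ::
    "nat \<Rightarrow> 'a pmf \<Rightarrow> ('a \<Rightarrow> real) \<Rightarrow> payment \<Rightarrow> (nat \<Rightarrow> strategy) \<Rightarrow> bool" where
  "nash_equilibrium N prior p \<tau> s \<longleftrightarrow>
     (\<forall>i<N. \<forall>sig. expected_payment N prior p \<tau> s i sig (s i sig)
                  \<ge> expected_payment N prior p \<tau> s i sig (\<not> s i sig))"

definition profile_of_counts ::
    "nat \<Rightarrow> nat \<Rightarrow> nat \<Rightarrow> nat \<Rightarrow> nat \<Rightarrow> (nat \<Rightarrow> strategy) \<Rightarrow> bool" where
  "profile_of_counts N n0 n1 nh nl s \<longleftrightarrow>
     card {i. i < N \<and> s i = s_neg} = n0 \<and>
     card {i. i < N \<and> s i = s_pos} = n1 \<and>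
     card {i. i < N \<and> s i = s_honest} = nh \<and>
     card {i. i < N \<and> s i = s_lie} = nl"

definition eps_payment :: "nat \<Rightarrow> real \<Rightarrow> real \<Rightarrow> real \<Rightarrow> payment" where
  "eps_payment N x y \<epsilon> r n =
     (if r then (if n = N - 1 then \<epsilon> else if n = N - 2 then y else 0)
      else (if n = 0 then \<epsilon> else if n = 1 then x else 0))"

end

theory Submission
  imports Defs
begin

text \<open>It suffices to treat \<open>\<epsilon> = 0\<close>: only finitely many profiles matter, expected payments are
  continuous in \<open>\<epsilon>\<close>, and a strictly profitable deviation at \<open>\<epsilon> = 0\<close> stays profitable for small
  \<open>\<epsilon>\<close>. At \<open>\<epsilon> = 0\<close> the equilibrium conditions compare combinations of the moments
  \<open>M i j = (\<Sum>\<theta>. Pr \<theta> * p \<theta> ^ i * (1 - p \<theta>) ^ j)\<close>. If both constant strategies occur, the conditions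
  of the two agents playing them contradict each other. Otherwise there are an honest agent and a
  liar; one takes the two conditions (one for each signal) of the liar if \<open>nl \<le> nh\<close> and of the
  honest agent if not. Multiplying them eliminates \<open>x\<close> and \<open>y\<close>, and the result contradicts the
  strict log-convexity of the moments of fixed degree \<open>i + j\<close>, supplemented by a quartic inequality
  in the balanced case \<open>n0 = n1 = 0\<close>, \<open>nh = nl\<close>.\<close>

section \<open>Counting reports\<close>

text \<open>Splitting by the unique coordinate \<open>j\<close> that satisfies \<open>Q\<close>
  gives disjoint product events; \<open>B j l\<close> is what such an event demands of coordinate
  \<open>l\<close>, and independence turns its probability into a product.\<close>

lemma measure_Pi_pmf_exactly_one:
  assumes "finite A"
  shows "measure_pmf.prob (Pi_pmf A d D) {f. card {j \<in> A. Q j (f j)} = 1} =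
    (\<Sum>j\<in>A. measure_pmf.prob (D j) {y. Q j y} *
       (\<Prod>l\<in>A - {j}. measure_pmf.prob (D l) {y. \<not> Q l y}))"
proof -
  define B where "B j l = {y. Q l y \<longleftrightarrow> l = j}" for j l
  have "{f. card {j \<in> A. Q j (f j)} = 1} = (\<Union>j\<in>A. Pi A (B j))"
    by (auto simp: card_1_singleton_iff B_def Pi_def set_eq_iff)
  moreover have "disjoint_family_on (\<lambda>j. Pi A (B j)) A"
    by (auto simp: disjoint_family_on_def B_def Pi_def)
  ultimately have "measure_pmf.prob (Pi_pmf A d D) {f. card {j \<in> A. Q j (f j)} = 1} =
      (\<Sum>j\<in>A. measure_pmf.prob (Pi_pmf A d D) (Pi A (B j)))"
    using assms by (simp add: measure_pmf.finite_measure_finite_Union)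
  also have "\<dots> = (\<Sum>j\<in>A. \<Prod>l\<in>A. measure_pmf.prob (D l) (B j l))"
    using assms by (simp add: measure_Pi_pmf_Pi)
  also have "\<dots> = (\<Sum>j\<in>A. measure_pmf.prob (D j) {y. Q j y} *
       (\<Prod>l\<in>A - {j}. measure_pmf.prob (D l) {y. \<not> Q l y}))"
  proof (rule sum.cong[OF refl])
    fix j assume "j \<in> A"
    then show "(\<Prod>l\<in>A. measure_pmf.prob (D l) (B j l)) = measure_pmf.prob (D j) {y. Q j y} *
       (\<Prod>l\<in>A - {j}. measure_pmf.prob (D l) {y. \<not> Q l y})"
      using assms by (auto simp: prod.remove[of A j] B_def intro!: prod.cong)
  qed
  finally show ?thesis .
qed

section \<open>Grouping agents by strategy\<close>

lemma UNIV_strategy: "(UNIV :: strategy set) = {s_honest, s_lie, s_pos, s_neg}"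
proof -
  have "f \<in> {s_honest, s_lie, s_pos, s_neg}" for f :: strategy
    by (cases "f True"; cases "f False")
      (auto simp: s_honest_def s_lie_def s_pos_def s_neg_def fun_eq_iff all_bool_eq)
  then show ?thesis by blast
qed

lemma strategies_distinct [simp]:
  "s_honest \<noteq> s_lie" "s_honest \<noteq> s_pos" "s_honest \<noteq> s_neg" "s_lie \<noteq> s_pos" "s_lie \<noteq> s_neg"
  "s_pos \<noteq> s_neg" "s_lie \<noteq> s_honest" "s_pos \<noteq> s_honest" "s_neg \<noteq> s_honest" "s_pos \<noteq> s_lie"
  "s_neg \<noteq> s_lie" "s_neg \<noteq> s_pos"
  by (simp_all add: s_honest_def s_lie_def s_pos_def s_neg_def fun_eq_iff all_bool_eq)

text \<open>\<open>A\<close> is a parameter because both all agents and the opponents of one agent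
  are counted.\<close>

definition num_playing :: "nat set \<Rightarrow> (nat \<Rightarrow> strategy) \<Rightarrow> strategy \<Rightarrow> nat" where
  "num_playing A s t = card {j \<in> A. s j = t}"

lemma num_playing_remove:
  assumes "finite A" "j \<in> A"
  shows "num_playing (A - {j}) s t = num_playing A s t - (if s j = t then 1 else 0)"
proof -
  have "{i \<in> A - {j}. s i = t} = {i \<in> A. s i = t} - {j}" by auto
  with assms show ?thesis by (simp add: num_playing_def)
qed

lemma sum_by_strategy:
  fixes g :: "strategy \<Rightarrow> real"
  assumes "finite A"
  shows "(\<Sum>j\<in>A. g (s j)) =
    num_playing A s s_honest * g s_honest + num_playing A s s_lie * g s_lie +
    num_playing A s s_pos * g s_pos + num_playing A s s_neg * g s_neg"
proof -
  have "(\<Sum>j\<in>A. g (s j)) = (\<Sum>t\<in>UNIV. \<Sum>j\<in>{j \<in> A. s j = t}. g (s j))"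
    using assms by (subst sum.group) auto
  also have "\<dots> = (\<Sum>t\<in>UNIV. num_playing A s t * g t)"
    by (simp add: num_playing_def)
  finally show ?thesis by (simp add: UNIV_strategy)
qed

lemma prod_by_strategy:
  fixes g :: "strategy \<Rightarrow> real"
  assumes "finite A"
  shows "(\<Prod>j\<in>A. g (s j)) =
    g s_honest ^ num_playing A s s_honest * g s_lie ^ num_playing A s s_lie *
    g s_pos ^ num_playing A s s_pos * g s_neg ^ num_playing A s s_neg"
proof -
  have "(\<Prod>j\<in>A. g (s j)) = (\<Prod>t\<in>UNIV. \<Prod>j\<in>{j \<in> A. s j = t}. g (s j))"
    using assms by (subst prod.group) auto
  also have "\<dots> = (\<Prod>t\<in>UNIV. g t ^ num_playing A s t)"
    by (simp add: num_playing_def)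
  finally show ?thesis by (simp add: UNIV_strategy)
qed

text \<open>Probability that exactly one report is 1 when \<open>a\<close> agents are honest, \<open>b\<close> lie and \<open>c\<close> always
  report 1. The exponent \<open>a - 1\<close> is harmless at \<open>a = 0\<close> because of the factor \<open>a\<close>; the same
  holds for \<open>b\<close> and \<open>c\<close>. Exchanging the two reports exchanges the roles of \<open>a\<close> and \<open>b\<close>.\<close>

definition single_prob :: "nat \<Rightarrow> nat \<Rightarrow> nat \<Rightarrow> real \<Rightarrow> real" where
  "single_prob a b c q =
     a * q * (1 - q) ^ (a - 1) * q ^ b * 0 ^ c +
     b * (1 - q) * (1 - q) ^ a * q ^ (b - 1) * 0 ^ c +
     c * (1 - q) ^ a * q ^ b * 0 ^ (c - 1)"

lemma measure_bernoulli_pmf: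
  assumes "0 \<le> q" "q \<le> 1"
  shows "measure_pmf.prob (bernoulli_pmf q) {y. Q y} =
    (if Q True then q else 0) + (if Q False then 1 - q else 0)"
proof -
  have "measure_pmf.prob (bernoulli_pmf q) {y. Q y} = (\<Sum>y\<in>{y. Q y}. pmf (bernoulli_pmf q) y)"
    by (simp add: measure_measure_pmf_finite)
  also have "\<dots> = (\<Sum>y\<in>UNIV. if Q y then pmf (bernoulli_pmf q) y else 0)"
    by (subst sum.inter_filter[symmetric]) auto
  finally show ?thesis using assms by (simp add: UNIV_bool)
qed

lemma prob_single_report:
  assumes "finite A" "0 \<le> q" "q \<le> 1"
  shows "measure_pmf.prob (Pi_pmf A d (\<lambda>_. bernoulli_pmf q)) {\<sigma>. card {j \<in> A. s j (\<sigma> j)} = 1} =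
    single_prob (num_playing A s s_honest) (num_playing A s s_lie) (num_playing A s s_pos) q"
proof -
  define r where "r t = measure_pmf.prob (bernoulli_pmf q) {y. t y}" for t :: strategy
  define r' where "r' t = measure_pmf.prob (bernoulli_pmf q) {y. \<not> t y}" for t :: strategy
  have r: "r s_honest = q" "r s_lie = 1 - q" "r s_pos = 1" "r s_neg = 0"
    "r' s_honest = 1 - q" "r' s_lie = q" "r' s_pos = 0" "r' s_neg = 1"
    using assms unfolding r_def r'_def
    by (simp_all add: measure_bernoulli_pmf s_honest_def s_lie_def s_pos_def s_neg_def)
  define n where "n = num_playing A s"
  \<comment> \<open>\<open>g t\<close> is the probability that the single report 1 comes from a
    given agent playing \<open>t\<close>. The exponents count the remaining agents; those playing
    \<open>s_neg\<close> contribute a factor 1, and \<open>0 ^ 0 = 1\<close> covers the absence of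
    further agents playing \<open>s_pos\<close>.\<close>
  define g where "g t = r t * ((1 - q) ^ (n s_honest - (if t = s_honest then 1 else 0)) *
      q ^ (n s_lie - (if t = s_lie then 1 else 0)) *
      0 ^ (n s_pos - (if t = s_pos then 1 else 0)))" for t
  have "measure_pmf.prob (Pi_pmf A d (\<lambda>_. bernoulli_pmf q)) {\<sigma>. card {j \<in> A. s j (\<sigma> j)} = 1} =
    (\<Sum>j\<in>A. r (s j) * (\<Prod>l\<in>A - {j}. r' (s l)))"
    unfolding r_def r'_def by (rule measure_Pi_pmf_exactly_one) fact
  also have "\<dots> = (\<Sum>j\<in>A. g (s j))"
    using assms by (intro sum.cong)
      (simp_all add: prod_by_strategy r num_playing_remove g_def n_def)
  also have "\<dots> = single_prob (n s_honest) (n s_lie) (n s_pos) q"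
    unfolding sum_by_strategy[OF assms(1)] n_def[symmetric]
    by (simp add: g_def r single_prob_def mult_ac)
  finally show ?thesis unfolding n_def .
qed

text \<open>Negating every strategy turns a single report 0 into a single report 1 and exchanges
  \<open>s_honest\<close> with \<open>s_lie\<close> and \<open>s_pos\<close> with
  \<open>s_neg\<close>. Nonemptiness of \<open>A\<close> keeps the truncated
  \<open>card A - 1\<close> exact.\<close>

lemma prob_single_negative_report:
  assumes "finite A" "0 \<le> q" "q \<le> 1" "A \<noteq> {}"
  shows "measure_pmf.prob (Pi_pmf A d (\<lambda>_. bernoulli_pmf q))
      {\<sigma>. card {j \<in> A. s j (\<sigma> j)} = card A - 1} =
    single_prob (num_playing A s s_lie) (num_playing A s s_honest) (num_playing A s s_neg) q"
proof -
  define s' :: "nat \<Rightarrow> strategy" where "s' j = (\<lambda>y. \<not> s j y)" for j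
  have "card {j \<in> A. s j (\<sigma> j)} = card A - 1 \<longleftrightarrow> card {j \<in> A. s' j (\<sigma> j)} = 1" for \<sigma>
  proof -
    have "card A = card ({j \<in> A. s j (\<sigma> j)} \<union> {j \<in> A. s' j (\<sigma> j)})"
      by (rule arg_cong[where f = card]) (auto simp: s'_def)
    also have "\<dots> = card {j \<in> A. s j (\<sigma> j)} + card {j \<in> A. s' j (\<sigma> j)}"
      using assms by (intro card_Un_disjoint) (auto simp: s'_def)
    finally show ?thesis using assms card_gt_0_iff[of A] by linarith
  qed
  moreover have "num_playing A s' t = num_playing A s (\<lambda>y. \<not> t y)" for t
    unfolding num_playing_def by (rule arg_cong[where f = card]) (auto simp: s'_def)
  moreover have "(\<lambda>y. \<not> s_honest y) = s_lie" "(\<lambda>y. \<not> s_lie y) = s_honest" "(\<lambda>y. \<not> s_pos y) = s_neg"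
    by (simp_all add: s_honest_def s_lie_def s_pos_def s_neg_def)
  ultimately show ?thesis
    using prob_single_report[of A q d s'] assms by simp
qed

section \<open>Expected payments\<close>

lemma finite_set_type_signal_pmf:
  assumes "finite (set_pmf prior)"
  shows "finite (set_pmf (type_signal_pmf N prior p))"
proof -
  have "finite (set_pmf (Pi_pmf {..<N} False (\<lambda>_. bernoulli_pmf q)))" for q
    by (rule finite_subset[OF set_Pi_pmf_subset']) auto
  with assms show ?thesis by (simp add: type_signal_pmf_def)
qed

lemma expectation_cond_pmf:
  fixes f :: "'b \<Rightarrow> real"
  assumes "finite (set_pmf M)" "set_pmf M \<inter> S \<noteq> {}"
  shows "measure_pmf.expectation (cond_pmf M S) f =
    measure_pmf.expectation M (\<lambda>x. indicator S x * f x) / measure_pmf.prob M S"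
proof -
  have "measure_pmf.expectation (cond_pmf M S) f = (\<Sum>x\<in>set_pmf M. f x * pmf (cond_pmf M S) x)"
    using assms by (intro integral_measure_pmf_real) auto
  also have "\<dots> = (\<Sum>x\<in>set_pmf M. indicator S x * f x * pmf M x) / measure_pmf.prob M S"
    unfolding sum_divide_distrib using assms
    by (intro sum.cong) (auto simp: pmf_cond indicator_def)
  also have "(\<Sum>x\<in>set_pmf M. indicator S x * f x * pmf M x) =
      measure_pmf.expectation M (\<lambda>x. indicator S x * f x)"
    using assms by (intro integral_measure_pmf_real[symmetric]) auto
  finally show ?thesis .
qed

text \<open>Given the type, the signal of \<open>i\<close> is independent of the other signals, and
  the count of the others' reports ignores coordinate \<open>i\<close>, so the contribution of each
  type factors.\<close>

lemma expectation_type_signal_pmf: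
  fixes g :: "nat \<Rightarrow> real"
  assumes "finite (set_pmf prior)" "i < N"
  shows "measure_pmf.expectation (type_signal_pmf N prior p)
      (\<lambda>x. indicator {(\<theta>, \<sigma>). \<sigma> i = sig} x *
         (case x of (\<theta>, \<sigma>) \<Rightarrow> g (positive_reports_of_others N s i \<sigma>))) =
    (\<Sum>\<theta>\<in>set_pmf prior. pmf prior \<theta> * pmf (bernoulli_pmf (p \<theta>)) sig *
       measure_pmf.expectation (Pi_pmf ({..<N} - {i}) False (\<lambda>_. bernoulli_pmf (p \<theta>)))
         (\<lambda>\<sigma>. g (card {j \<in> {..<N} - {i}. s j (\<sigma> j)})))"
    (is "measure_pmf.expectation _ ?h = _")
proof -
  let ?A = "{..<N} - {i}"
  have fin: "finite (set_pmf (Pi_pmf A False (\<lambda>_. bernoulli_pmf q)))" if "finite A" for q and A :: "nat set"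
    using that by (intro finite_subset[OF set_Pi_pmf_subset']) auto
  have ins: "{..<N} = insert i ?A" using assms by auto
  have count: "positive_reports_of_others N s i (\<sigma>(i := y)) = card {j \<in> ?A. s j (\<sigma> j)}" for \<sigma> y
    unfolding positive_reports_of_others_def by (rule arg_cong[where f = card]) auto
  have "measure_pmf.expectation
      (Pi_pmf {..<N} False (\<lambda>_. bernoulli_pmf q) \<bind> (\<lambda>\<sigma>. return_pmf (\<theta>, \<sigma>))) ?h =
      pmf (bernoulli_pmf q) sig *
       measure_pmf.expectation (Pi_pmf ?A False (\<lambda>_. bernoulli_pmf q))
         (\<lambda>\<sigma>. g (card {j \<in> ?A. s j (\<sigma> j)}))" for \<theta> q
  proof -
    have "Pi_pmf {..<N} False (\<lambda>_. bernoulli_pmf q) \<bind> (\<lambda>\<sigma>. return_pmf (\<theta>, \<sigma>)) =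
        bernoulli_pmf q \<bind> (\<lambda>y. map_pmf (\<lambda>\<sigma>. (\<theta>, \<sigma>(i := y))) (Pi_pmf ?A False (\<lambda>_. bernoulli_pmf q)))"
      by (subst ins, subst Pi_pmf_insert')
        (auto simp: map_pmf_def bind_assoc_pmf bind_return_pmf)
    then have "measure_pmf.expectation
        (Pi_pmf {..<N} False (\<lambda>_. bernoulli_pmf q) \<bind> (\<lambda>\<sigma>. return_pmf (\<theta>, \<sigma>))) ?h =
        (\<Sum>y\<in>UNIV. pmf (bernoulli_pmf q) y *
          measure_pmf.expectation (Pi_pmf ?A False (\<lambda>_. bernoulli_pmf q)) (\<lambda>\<sigma>. ?h (\<theta>, \<sigma>(i := y))))"
      using fin[of ?A] by (simp add: pmf_expectation_bind[where A = UNIV])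
    also have "\<dots> = (\<Sum>y\<in>UNIV. if y = sig then pmf (bernoulli_pmf q) y *
         measure_pmf.expectation (Pi_pmf ?A False (\<lambda>_. bernoulli_pmf q))
           (\<lambda>\<sigma>. g (card {j \<in> ?A. s j (\<sigma> j)})) else 0)"
      by (intro sum.cong) (auto simp: count)
    finally show ?thesis by simp
  qed
  then show ?thesis
    unfolding type_signal_pmf_def using assms(1) fin[of "{..<N}"]
    by (subst pmf_expectation_bind[OF assms(1)]) (auto simp: mult.assoc intro!: sum.cong)
qed

text \<open>Bayes' law: the denominator is the probability of the observation, and its positivity
  makes the conditional distribution meaningful.\<close>

lemma expected_payment_eq:
  assumes "finite (set_pmf prior)" "\<forall>\<theta>\<in>set_pmf prior. 0 < p \<theta> \<and> p \<theta> < 1" "i < N"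
  shows "expected_payment N prior p \<tau> s i sig r =
    (\<Sum>\<theta>\<in>set_pmf prior. pmf prior \<theta> * pmf (bernoulli_pmf (p \<theta>)) sig *
       measure_pmf.expectation (Pi_pmf ({..<N} - {i}) False (\<lambda>_. bernoulli_pmf (p \<theta>)))
         (\<lambda>\<sigma>. \<tau> r (card {j \<in> {..<N} - {i}. s j (\<sigma> j)}))) /
    (\<Sum>\<theta>\<in>set_pmf prior. pmf prior \<theta> * pmf (bernoulli_pmf (p \<theta>)) sig)"
    and "(\<Sum>\<theta>\<in>set_pmf prior. pmf prior \<theta> * pmf (bernoulli_pmf (p \<theta>)) sig) > 0"
proof -
  let ?M = "type_signal_pmf N prior p" and ?S = "{(\<theta> :: 'a, \<sigma> :: nat \<Rightarrow> bool). \<sigma> i = sig}"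
  have fin: "finite (set_pmf ?M)" using assms by (rule_tac finite_set_type_signal_pmf)
  have pos: "pmf (bernoulli_pmf (p \<theta>)) sig > 0" if "\<theta> \<in> set_pmf prior" for \<theta>
    using assms(2) that by (cases sig) (auto simp: less_imp_le)
  show gt0: "(\<Sum>\<theta>\<in>set_pmf prior. pmf prior \<theta> * pmf (bernoulli_pmf (p \<theta>)) sig) > 0"
    using assms(1) pos by (intro sum_pos) (auto simp: pmf_positive set_pmf_not_empty)
  \<comment> \<open>The constant payment 1 yields the probability of the observation.\<close>
  have meas: "measure_pmf.prob ?M ?S = (\<Sum>\<theta>\<in>set_pmf prior. pmf prior \<theta> * pmf (bernoulli_pmf (p \<theta>)) sig)"
    using expectation_type_signal_pmf[OF assms(1,3), of p sig "\<lambda>_. 1"] by (simp add: case_prod_beta')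
  then have ne: "set_pmf ?M \<inter> ?S \<noteq> {}"
    using gt0 by (auto simp: measure_pmf_zero_iff[symmetric])
  show "expected_payment N prior p \<tau> s i sig r =
    (\<Sum>\<theta>\<in>set_pmf prior. pmf prior \<theta> * pmf (bernoulli_pmf (p \<theta>)) sig *
       measure_pmf.expectation (Pi_pmf ({..<N} - {i}) False (\<lambda>_. bernoulli_pmf (p \<theta>)))
         (\<lambda>\<sigma>. \<tau> r (card {j \<in> {..<N} - {i}. s j (\<sigma> j)}))) /
    (\<Sum>\<theta>\<in>set_pmf prior. pmf prior \<theta> * pmf (bernoulli_pmf (p \<theta>)) sig)"
    unfolding expected_payment_def expectation_cond_pmf[OF fin ne] meas
    using expectation_type_signal_pmf[OF assms(1,3), of p sig "\<tau> r"] by simp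
qed

lemma expected_payment_eps_continuous:
  assumes "finite (set_pmf prior)" "\<forall>\<theta>\<in>set_pmf prior. 0 < p \<theta> \<and> p \<theta> < 1" "i < N"
  shows "((\<lambda>\<epsilon>. expected_payment N prior p (eps_payment N x y \<epsilon>) s i sig r) \<longlongrightarrow>
    expected_payment N prior p (eps_payment N x y 0) s i sig r) (at_right 0)"
proof -
  have tau: "((\<lambda>\<epsilon>. eps_payment N x y \<epsilon> r n) \<longlongrightarrow> eps_payment N x y 0 r n) (at_right 0)" for n
    unfolding eps_payment_def by (auto intro!: tendsto_eq_intros)
  \<comment> \<open>Over the fixed finite set of signal vectors an expectation is a finite sum, so
    limits may be taken termwise.\<close>
  have E: "measure_pmf.expectation (Pi_pmf A False (\<lambda>_. bernoulli_pmf q)) f =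
      (\<Sum>\<sigma>\<in>PiE_dflt A False (\<lambda>_. UNIV). f \<sigma> * pmf (Pi_pmf A False (\<lambda>_. bernoulli_pmf q)) \<sigma>)"
    if "finite A" for A :: "nat set" and q and f :: "_ \<Rightarrow> real"
  proof (rule integral_measure_pmf_real)
    show "finite (PiE_dflt A False (\<lambda>_. UNIV :: bool set))"
      using that by (rule finite_PiE_dflt) auto
    show "\<sigma> \<in> PiE_dflt A False (\<lambda>_. UNIV)" if "\<sigma> \<in> set_pmf (Pi_pmf A False (\<lambda>_. bernoulli_pmf q))" for \<sigma>
      using that set_Pi_pmf_subset[OF \<open>finite A\<close>, of False "\<lambda>_. bernoulli_pmf q"]
      by (auto simp: PiE_dflt_def)
  qed
  show ?thesis
    unfolding expected_payment_eq(1)[OF assms] using expected_payment_eq(2)[OF assms, where sig = sig]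
    by (auto simp: E intro!: tendsto_intros tau)
qed

text \<open>\<open>N - 1 - 1\<close> is \<open>card A - 1\<close> for the set \<open>A\<close> of
  the \<open>N - 1\<close> opponents: report 1 is paid when exactly one opponent reports 0.\<close>

lemma eps_payment_0:
  assumes "N > 4"
  shows "eps_payment N x y 0 r n =
    (if r then y * indicator {N - 1 - 1} n else x * indicator {1} n)"
  using assms by (auto simp: eps_payment_def numeral_2_eq_2)

text \<open>The expected payments for both reports share the positive denominator \<open>Z\<close>,
  which cancels; the remaining expectations of indicators are probabilities of a single 1 or a
  single 0 among the opponents.\<close>

lemma nash_eps_payment_0:
  assumes "finite (set_pmf prior)" "\<forall>\<theta>\<in>set_pmf prior. 0 < p \<theta> \<and> p \<theta> < 1" "N > 4"
    and "nash_equilibrium N prior p (eps_payment N x y 0) s" "i < N"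
  defines "A \<equiv> {..<N} - {i}"
  defines "U \<equiv> \<lambda>sig a b c.
     \<Sum>\<theta>\<in>set_pmf prior. pmf prior \<theta> * pmf (bernoulli_pmf (p \<theta>)) sig * single_prob a b c (p \<theta>)"
  defines "U0 \<equiv> \<lambda>sig. x * U sig (num_playing A s s_honest) (num_playing A s s_lie) (num_playing A s s_pos)"
  defines "U1 \<equiv> \<lambda>sig. y * U sig (num_playing A s s_lie) (num_playing A s s_honest) (num_playing A s s_neg)"
  shows "s i sig \<Longrightarrow> U0 sig \<le> U1 sig" "\<not> s i sig \<Longrightarrow> U1 sig \<le> U0 sig"
proof -
  have fin: "finite A" and cardA: "card A = N - 1"
    using assms(5) by (auto simp: A_def)
  have ne: "A \<noteq> {}" using cardA assms(3) by force
  define Z where "Z = (\<Sum>\<theta>\<in>set_pmf prior. pmf prior \<theta> * pmf (bernoulli_pmf (p \<theta>)) sig)"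
  have Z: "Z > 0" unfolding Z_def by (rule expected_payment_eq(2)[OF assms(1,2,5)])
  have vimage: "(\<lambda>\<sigma>. indicator {k} (f \<sigma>) :: real) = indicator {\<sigma>. f \<sigma> = k}"
    for k :: nat and f :: "(nat \<Rightarrow> bool) \<Rightarrow> nat"
    by (auto simp: indicator_def)
  have p: "0 \<le> p \<theta>" "p \<theta> \<le> 1" if "\<theta> \<in> set_pmf prior" for \<theta>
    using assms(2) that by auto
  have "expected_payment N prior p (eps_payment N x y 0) s i sig False = U0 sig / Z"
    unfolding expected_payment_eq(1)[OF assms(1,2,5)] Z_def[symmetric] A_def[symmetric]
    unfolding eps_payment_0[OF assms(3)] U0_def U_def sum_distrib_left
    by (intro arg_cong2[where f = "(/)"] refl sum.cong)
      (simp add: vimage prob_single_report[OF fin p, unfolded One_nat_def])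
  moreover have "expected_payment N prior p (eps_payment N x y 0) s i sig True = U1 sig / Z"
    unfolding expected_payment_eq(1)[OF assms(1,2,5)] Z_def[symmetric] A_def[symmetric]
    unfolding eps_payment_0[OF assms(3)] U1_def U_def sum_distrib_left cardA[symmetric]
    by (intro arg_cong2[where f = "(/)"] refl sum.cong)
      (simp add: vimage prob_single_negative_report[OF fin p ne, unfolded One_nat_def])
  moreover have "expected_payment N prior p (eps_payment N x y 0) s i sig (s i sig)
      \<ge> expected_payment N prior p (eps_payment N x y 0) s i sig (\<not> s i sig)"
    using assms(4,5) unfolding nash_equilibrium_def by blast
  ultimately show "s i sig \<Longrightarrow> U0 sig \<le> U1 sig" "\<not> s i sig \<Longrightarrow> U1 sig \<le> U0 sig"
    using Z by (auto simp: divide_le_cancel)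
qed

section \<open>Reduction to \<open>\<epsilon> = 0\<close>\<close>

lemma expected_payment_cong:
  assumes "\<And>j. j < N \<Longrightarrow> s j = s' j"
  shows "expected_payment N prior p \<tau> s = expected_payment N prior p \<tau> s'"
proof -
  have "positive_reports_of_others N s = positive_reports_of_others N s'"
    unfolding positive_reports_of_others_def using assms
    by (intro ext arg_cong[where f = card]) auto
  then show ?thesis by (simp add: expected_payment_def fun_eq_iff)
qed

lemma nash_equilibrium_cong:
  assumes "\<And>j. j < N \<Longrightarrow> s j = s' j"
  shows "nash_equilibrium N prior p \<tau> s \<longleftrightarrow> nash_equilibrium N prior p \<tau> s'"
  using expected_payment_cong[of N s s' prior p \<tau>, OF assms] assms by (auto simp: nash_equilibrium_def)

lemma eventually_not_nash_equilibrium: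
  assumes "finite (set_pmf prior)" "\<forall>\<theta>\<in>set_pmf prior. 0 < p \<theta> \<and> p \<theta> < 1"
  shows "\<forall>\<^sub>F \<epsilon> in at_right 0. \<forall>s. \<not> nash_equilibrium N prior p (eps_payment N x y 0) s \<longrightarrow>
    \<not> nash_equilibrium N prior p (eps_payment N x y \<epsilon>) s"
proof -
  let ?nash = "\<lambda>\<epsilon>. nash_equilibrium N prior p (eps_payment N x y \<epsilon>)"
  \<comment> \<open>Profiles normalised to \<open>s_neg\<close> from index \<open>N\<close> on
    represent all profiles. Since \<open>S\<close> is finite, one range of \<open>\<epsilon>\<close>
    serves every profile at once.\<close>
  define S :: "(nat \<Rightarrow> strategy) set" where "S = PiE_dflt {..<N} s_neg (\<lambda>_. UNIV)"
  have "finite S" unfolding S_def by (intro finite_PiE_dflt) auto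
  moreover have "\<forall>\<^sub>F \<epsilon> in at_right 0. \<not> ?nash 0 s \<longrightarrow> \<not> ?nash \<epsilon> s" for s
  proof (cases "?nash 0 s")
    case False
    then obtain i sig where i: "i < N" and
      "expected_payment N prior p (eps_payment N x y 0) s i sig (s i sig) <
       expected_payment N prior p (eps_payment N x y 0) s i sig (\<not> s i sig)"
      by (auto simp: nash_equilibrium_def not_le)
    then have "\<forall>\<^sub>F \<epsilon> in at_right 0. 0 < expected_payment N prior p (eps_payment N x y \<epsilon>) s i sig (\<not> s i sig) -
       expected_payment N prior p (eps_payment N x y \<epsilon>) s i sig (s i sig)"
      by (intro order_tendstoD(1)[OF tendsto_diff[OF expected_payment_eps_continuous
            expected_payment_eps_continuous]] assms) auto
    then show ?thesis
    proof eventually_elim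
      case (elim \<epsilon>)
      then show ?case using i unfolding nash_equilibrium_def by (metis diff_gt_0_iff_gt not_le)
    qed
  qed auto
  ultimately have "\<forall>\<^sub>F \<epsilon> in at_right 0. \<forall>s\<in>S. \<not> ?nash 0 s \<longrightarrow> \<not> ?nash \<epsilon> s"
    by (intro eventually_ball_finite) auto
  then show ?thesis
  proof eventually_elim
    case (elim \<epsilon>)
    show ?case
    proof
      fix s
      define s' where "s' j = (if j < N then s j else s_neg)" for j
      have "s' \<in> S" by (auto simp: S_def s'_def PiE_dflt_def)
      moreover have "?nash \<delta> s = ?nash \<delta> s'" for \<delta>
        by (rule nash_equilibrium_cong) (simp add: s'_def)
      ultimately show "\<not> ?nash 0 s \<longrightarrow> \<not> ?nash \<epsilon> s" using elim by auto
    qed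
  qed
qed

section \<open>Moments of the signal probabilities\<close>

text \<open>The contribution of one pair of types, with \<open>b\<close>, \<open>b'\<close> standing
  for the probabilities of signal 0. For positive arguments the last two differences have the same
  sign.\<close>

lemma two_point_log_convex_identity:
  fixes a b a' b' :: real
  shows "(a ^ i * b ^ (j + d + e)) * (a' ^ (i + d + e) * b' ^ j) +
      (a ^ (i + d + e) * b ^ j) * (a' ^ i * b' ^ (j + d + e)) -
    ((a ^ (i + e) * b ^ (j + d)) * (a' ^ (i + d) * b' ^ (j + e)) +
      (a ^ (i + d) * b ^ (j + e)) * (a' ^ (i + e) * b' ^ (j + d))) =
    (a * a') ^ i * (b * b') ^ j * (((a * b') ^ e - (a' * b) ^ e) * ((a * b') ^ d - (a' * b) ^ d))"
  by (simp add: power_add algebra_simps)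

text \<open>Binomial expansion of the fourth power; its coefficient 6 appears as 3 times a doubled
  term, to match symmetrized products of moments.\<close>

lemma two_point_quartic_identity:
  fixes a b a' b' :: real
  shows "(a ^ i * b ^ (j + 4)) * (a' ^ (i + 4) * b' ^ j) + (a ^ (i + 4) * b ^ j) * (a' ^ i * b' ^ (j + 4)) +
    3 * ((a ^ (i + 2) * b ^ (j + 2)) * (a' ^ (i + 2) * b' ^ (j + 2)) +
      (a ^ (i + 2) * b ^ (j + 2)) * (a' ^ (i + 2) * b' ^ (j + 2))) -
    4 * ((a ^ (i + 1) * b ^ (j + 3)) * (a' ^ (i + 3) * b' ^ (j + 1)) +
      (a ^ (i + 3) * b ^ (j + 1)) * (a' ^ (i + 1) * b' ^ (j + 3))) =
    (a * a') ^ i * (b * b') ^ j * (a * b' - a' * b) ^ 4"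
  by (simp add: power_add algebra_simps power4_eq_xxxx power2_eq_square power3_eq_cube)

locale binary_types =
  fixes prior :: "'a pmf" and p :: "'a \<Rightarrow> real"
  assumes finite_types: "finite (set_pmf prior)"
    and p_bounds: "\<forall>\<theta>\<in>set_pmf prior. 0 < p \<theta> \<and> p \<theta> < 1"
    and distinct_types: "\<exists>\<theta>\<in>set_pmf prior. \<exists>\<theta>'\<in>set_pmf prior. p \<theta> \<noteq> p \<theta>'"
begin

definition moment :: "nat \<Rightarrow> nat \<Rightarrow> real" where
  "moment i j = (\<Sum>\<theta>\<in>set_pmf prior. pmf prior \<theta> * (p \<theta> ^ i * (1 - p \<theta>) ^ j))"

lemma moment_pos: "moment i j > 0"
  unfolding moment_def using finite_types p_bounds
  by (intro sum_pos) (auto simp: pmf_positive set_pmf_not_empty)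

lemma moment_nonneg [simp]: "moment i j \<ge> 0"
  using moment_pos[of i j] by simp

text \<open>Symmetrizing over ordered pairs of types lets the two-point identities apply termwise;
  the factor 2 avoids halves.\<close>

lemma moment_mult_symmetrized:
  "2 * (moment a b * moment c d) =
    (\<Sum>\<theta>\<in>set_pmf prior. \<Sum>\<theta>'\<in>set_pmf prior. pmf prior \<theta> * pmf prior \<theta>' *
      ((p \<theta> ^ a * (1 - p \<theta>) ^ b) * (p \<theta>' ^ c * (1 - p \<theta>') ^ d) +
       (p \<theta> ^ c * (1 - p \<theta>) ^ d) * (p \<theta>' ^ a * (1 - p \<theta>') ^ b)))"
proof -
  have "2 * (moment a b * moment c d) = moment a b * moment c d + moment c d * moment a b"
    by simp
  also have "\<dots> = (\<Sum>\<theta>\<in>set_pmf prior. \<Sum>\<theta>'\<in>set_pmf prior. pmf prior \<theta> * pmf prior \<theta>' *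
      ((p \<theta> ^ a * (1 - p \<theta>) ^ b) * (p \<theta>' ^ c * (1 - p \<theta>') ^ d) +
       (p \<theta> ^ c * (1 - p \<theta>) ^ d) * (p \<theta>' ^ a * (1 - p \<theta>') ^ b)))"
    unfolding moment_def sum_product sum.distrib[symmetric]
    by (intro sum.cong refl) (simp add: algebra_simps)
  finally show ?thesis .
qed

lemma double_sum_nonneg:
  assumes "\<And>\<theta> \<theta>'. \<theta> \<in> set_pmf prior \<Longrightarrow> \<theta>' \<in> set_pmf prior \<Longrightarrow> g \<theta> \<theta>' \<ge> (0::real)"
  shows "0 \<le> (\<Sum>\<theta>\<in>set_pmf prior. \<Sum>\<theta>'\<in>set_pmf prior. pmf prior \<theta> * pmf prior \<theta>' * g \<theta> \<theta>')"
  using assms by (intro sum_nonneg mult_nonneg_nonneg) auto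

lemma double_sum_pos:
  assumes "\<And>\<theta> \<theta>'. \<theta> \<in> set_pmf prior \<Longrightarrow> \<theta>' \<in> set_pmf prior \<Longrightarrow> g \<theta> \<theta>' \<ge> (0::real)"
    and "\<And>\<theta> \<theta>'. \<theta> \<in> set_pmf prior \<Longrightarrow> \<theta>' \<in> set_pmf prior \<Longrightarrow> p \<theta> \<noteq> p \<theta>' \<Longrightarrow> g \<theta> \<theta>' > 0"
  shows "0 < (\<Sum>\<theta>\<in>set_pmf prior. \<Sum>\<theta>'\<in>set_pmf prior. pmf prior \<theta> * pmf prior \<theta>' * g \<theta> \<theta>')"
proof -
  obtain \<theta> \<theta>' where t: "\<theta> \<in> set_pmf prior" "\<theta>' \<in> set_pmf prior" "p \<theta> \<noteq> p \<theta>'"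
    using distinct_types by blast
  have nonneg: "0 \<le> pmf prior u * pmf prior v * g u v"
    if "u \<in> set_pmf prior" "v \<in> set_pmf prior" for u v
    using assms(1)[OF that] by simp
  have "0 < pmf prior \<theta> * pmf prior \<theta>' * g \<theta> \<theta>'"
    using assms(2)[OF t] t by (simp add: pmf_positive)
  then have "0 < (\<Sum>\<theta>'\<in>set_pmf prior. pmf prior \<theta> * pmf prior \<theta>' * g \<theta> \<theta>')"
    by (rule sum_pos2[OF finite_types t(2)]) (simp add: nonneg t)
  then show ?thesis
    by (rule sum_pos2[OF finite_types t(1)]) (simp add: nonneg sum_nonneg)
qed

text \<open>All four moments have the same degree, and \<open>a1\<close>, \<open>a2\<close> lie
  between \<open>c1\<close> and \<open>c2\<close> with the same sum: moving the first exponents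
  apart increases the product.\<close>

lemma
  assumes "c1 \<le> a1" "c1 \<le> a2" "a1 + a2 = c1 + c2"
    and "a1 + b1 = c1 + d1" "a2 + b2 = c1 + d1" "c2 + d2 = c1 + d1"
  shows moment_log_convex: "moment a1 b1 * moment a2 b2 \<le> moment c1 d1 * moment c2 d2" (is ?le)
    and moment_log_convex_strict: "c1 < a1 \<Longrightarrow> c1 < a2 \<Longrightarrow>
      moment a1 b1 * moment a2 b2 < moment c1 d1 * moment c2 d2" (is "_ \<Longrightarrow> _ \<Longrightarrow> ?less")
proof -
  \<comment> \<open>The distances of the inner exponents from the lower end \<open>c1\<close> bring
    all exponents into the form of the two-point identity.\<close>
  define d e where "d = a2 - c1" and "e = a1 - c1"
  have exps: "a1 = c1 + e" "a2 = c1 + d" "c2 = c1 + d + e" "b1 = d2 + d" "b2 = d2 + e" "d1 = d2 + d + e"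
    using assms by (auto simp: d_def e_def)
  define g where "g \<theta> \<theta>' = (p \<theta> * p \<theta>') ^ c1 * ((1 - p \<theta>) * (1 - p \<theta>')) ^ d2 *
     (((p \<theta> * (1 - p \<theta>')) ^ e - (p \<theta>' * (1 - p \<theta>)) ^ e) *
      ((p \<theta> * (1 - p \<theta>')) ^ d - (p \<theta>' * (1 - p \<theta>)) ^ d))" for \<theta> \<theta>'
  have eq: "2 * (moment c1 d1 * moment c2 d2) - 2 * (moment a1 b1 * moment a2 b2) =
      (\<Sum>\<theta>\<in>set_pmf prior. \<Sum>\<theta>'\<in>set_pmf prior. pmf prior \<theta> * pmf prior \<theta>' * g \<theta> \<theta>')"
    unfolding moment_mult_symmetrized sum_subtractf[symmetric] exps g_def
    by (intro sum.cong refl) (simp only: right_diff_distrib[symmetric] two_point_log_convex_identity)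
  have pos: "0 < p \<theta>" "0 < 1 - p \<theta>" if "\<theta> \<in> set_pmf prior" for \<theta>
    using p_bounds that by auto
  have nonneg: "g \<theta> \<theta>' \<ge> 0" if "\<theta> \<in> set_pmf prior" "\<theta>' \<in> set_pmf prior" for \<theta> \<theta>'
  proof -
    have "((A::real) ^ e - B ^ e) * (A ^ d - B ^ d) \<ge> 0" if "A > 0" "B > 0" for A B
      using that power_mono[of A B e] power_mono[of A B d] power_mono[of B A e] power_mono[of B A d]
      by (cases "A \<le> B") (auto intro: mult_nonneg_nonneg mult_nonpos_nonpos)
    then show ?thesis
      unfolding g_def using pos[OF that(1)] pos[OF that(2)]
      by (intro mult_nonneg_nonneg[OF mult_nonneg_nonneg]) auto
  qed
  show ?le using eq double_sum_nonneg[of g] nonneg by simp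
  assume "c1 < a1" "c1 < a2"
  then have de: "d > 0" "e > 0" by (auto simp: d_def e_def)
  have "g \<theta> \<theta>' > 0" if "\<theta> \<in> set_pmf prior" "\<theta>' \<in> set_pmf prior" "p \<theta> \<noteq> p \<theta>'" for \<theta> \<theta>'
  proof -
    have "((A::real) ^ e - B ^ e) * (A ^ d - B ^ d) > 0" if "A > 0" "B > 0" "A \<noteq> B" for A B
      using that de power_strict_mono[of A B e] power_strict_mono[of A B d]
        power_strict_mono[of B A e] power_strict_mono[of B A d]
      by (cases "A < B") (auto intro: mult_pos_pos mult_neg_neg)
    \<comment> \<open>The difference of the two sides is
      \<open>p \<theta> - p \<theta>'\<close>.\<close>
    moreover have "p \<theta> * (1 - p \<theta>') \<noteq> p \<theta>' * (1 - p \<theta>)"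
      using that by (simp add: algebra_simps)
    ultimately show ?thesis
      unfolding g_def using pos[OF that(1)] pos[OF that(2)]
      by (intro mult_pos_pos[OF mult_pos_pos]) auto
  qed
  then show ?less using eq double_sum_pos[of g] nonneg by simp
qed

text \<open>The left-hand side is half the sum over pairs of types of a multiple of
  \<open>(p \<theta> (1 - p \<theta>') - p \<theta>' (1 - p \<theta>))\<^sup>4\<close>.\<close>

lemma moment_quartic:
  "0 \<le> moment i (j + 4) * moment (i + 4) j + 3 * (moment (i + 2) (j + 2) * moment (i + 2) (j + 2)) -
    4 * (moment (i + 1) (j + 3) * moment (i + 3) (j + 1))"
proof -
  define g where "g \<theta> \<theta>' = (p \<theta> * p \<theta>') ^ i * ((1 - p \<theta>) * (1 - p \<theta>')) ^ j *
     (p \<theta> * (1 - p \<theta>') - p \<theta>' * (1 - p \<theta>)) ^ 4" for \<theta> \<theta>'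
  have combine: "w * X + 3 * (w * Y) - 4 * (w * Z) = w * (X + 3 * Y - 4 * Z)" for w X Y Z :: real
    by (simp add: algebra_simps)
  have "2 * (moment i (j + 4) * moment (i + 4) j) +
      3 * (2 * (moment (i + 2) (j + 2) * moment (i + 2) (j + 2))) -
      4 * (2 * (moment (i + 1) (j + 3) * moment (i + 3) (j + 1))) =
      (\<Sum>\<theta>\<in>set_pmf prior. \<Sum>\<theta>'\<in>set_pmf prior. pmf prior \<theta> * pmf prior \<theta>' * g \<theta> \<theta>')"
    unfolding moment_mult_symmetrized sum_distrib_left sum.distrib[symmetric] sum_subtractf[symmetric] g_def
    by (intro sum.cong refl) (simp only: combine two_point_quartic_identity)
  moreover have "g \<theta> \<theta>' \<ge> 0" if "\<theta> \<in> set_pmf prior" "\<theta>' \<in> set_pmf prior" for \<theta> \<theta>'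
    unfolding g_def using p_bounds that
    by (intro mult_nonneg_nonneg[OF mult_nonneg_nonneg]) (auto simp: less_imp_le)
  ultimately show ?thesis using double_sum_nonneg[of g] by simp
qed

text \<open>The probability that an agent observes \<open>sig\<close> and exactly one opponent
  reports 1, the opponents comprising \<open>a\<close> honest agents, \<open>b\<close> liars and
  \<open>c\<close> playing \<open>s_pos\<close>. With \<open>a\<close> and \<open>b\<close> swapped
  and \<open>c\<close> counting \<open>s_neg\<close>, it concerns a single report 0.\<close>

definition score :: "bool \<Rightarrow> nat \<Rightarrow> nat \<Rightarrow> nat \<Rightarrow> real" where
  "score sig a b c =
    (\<Sum>\<theta>\<in>set_pmf prior. pmf prior \<theta> * pmf (bernoulli_pmf (p \<theta>)) sig * single_prob a b c (p \<theta>))"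

lemma pmf_bernoulli_type:
  assumes "\<theta> \<in> set_pmf prior"
  shows "pmf (bernoulli_pmf (p \<theta>)) True = p \<theta>" "pmf (bernoulli_pmf (p \<theta>)) False = 1 - p \<theta>"
  using assms p_bounds by (auto simp: less_imp_le)

text \<open>The observation adds one factor \<open>p \<theta>\<close> or
  \<open>1 - p \<theta>\<close> to each term of \<open>single_prob\<close>. Truncated exponents
  occur only where the coefficient \<open>a\<close> or \<open>b\<close> vanishes.\<close>

lemma score_0:
  "score True a b 0 = a * moment (b + 2) (a - 1) + b * moment b (a + 1)"
  "score False a b 0 = a * moment (b + 1) a + b * moment (b - 1) (a + 2)"
proof -
  have "w * q * single_prob a b 0 q =
      a * (w * (q ^ (b + 2) * (1 - q) ^ (a - 1))) + b * (w * (q ^ b * (1 - q) ^ (a + 1)))" for w q :: real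
  proof -
    define r where "r = 1 - q"
    show ?thesis unfolding single_prob_def r_def[symmetric] by (cases b) (simp_all add: algebra_simps)
  qed
  then show "score True a b 0 = a * moment (b + 2) (a - 1) + b * moment b (a + 1)"
    unfolding score_def moment_def sum_distrib_left sum.distrib[symmetric]
    by (intro sum.cong refl) (simp only: pmf_bernoulli_type)
  have "w * (1 - q) * single_prob a b 0 q =
      a * (w * (q ^ (b + 1) * (1 - q) ^ a)) + b * (w * (q ^ (b - 1) * (1 - q) ^ (a + 2)))" for w q :: real
  proof -
    define r where "r = 1 - q"
    show ?thesis unfolding single_prob_def r_def[symmetric] by (cases a) (simp_all add: algebra_simps)
  qed
  then show "score False a b 0 = a * moment (b + 1) a + b * moment (b - 1) (a + 2)"
    unfolding score_def moment_def sum_distrib_left sum.distrib[symmetric]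
    by (intro sum.cong refl) (simp only: pmf_bernoulli_type)
qed

text \<open>The only report 1 must be that of the agent playing \<open>s_pos\<close>: the factor
  \<open>0 ^ c\<close> removes the other terms.\<close>

lemma score_1:
  "score True a b 1 = moment (b + 1) a"
  "score False a b 1 = moment b (a + 1)"
  unfolding score_def moment_def single_prob_def
  by (intro sum.cong refl; simp add: pmf_bernoulli_type mult_ac)+

lemma score_nonneg [simp]: "score sig a b c \<ge> 0"
  unfolding score_def single_prob_def using p_bounds
  by (intro sum_nonneg mult_nonneg_nonneg add_nonneg_nonneg) (auto simp: less_imp_le)

text \<open>For \<open>c = c' = 0\<close> and \<open>a = b + 1\<close> the coefficient of \<open>a\<^sup>2\<close> has the wrong sign; the quartic
  inequality lets the coefficient of \<open>b\<^sup>2\<close> compensate, as \<open>3 b\<^sup>2 \<ge> (b + 1)\<^sup>2\<close>.\<close>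

lemma score_mult_less:
  assumes "b < a" "a + b + c + c' > 3" "c \<le> 1" "c' \<le> 1" "\<not> (c = 1 \<and> c' = 1)"
  shows "score True a b c * score False b a c' < score False a b c * score True b a c'"
proof -
  consider "c = 0" "c' = 1" | "c = 1" "c' = 0" | "c = 0" "c' = 0"
    using assms by linarith
  then show ?thesis
  proof cases
    case 1
    \<comment> \<open>The \<open>P\<close> terms expand the left product and the \<open>Q\<close>
      terms the right one; index 1 carries the coefficient \<open>a\<close>, index 2 the coefficient
      \<open>b\<close>.\<close>
    define P1 Q1 P2 Q2 where "P1 = moment (b + 2) (a - 1) * moment a (b + 1)"
      and "Q1 = moment (b + 1) a * moment (a + 1) b"
      and "P2 = moment b (a + 1) * moment a (b + 1)"
      and "Q2 = moment (b - 1) (a + 2) * moment (a + 1) b"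
    have le1: "P1 \<le> Q1" unfolding P1_def Q1_def using assms by (intro moment_log_convex) auto
    have "real a * P1 + real b * P2 < real a * Q1 + real b * Q2"
    \<comment> \<open>Strictness normally comes from index 2. For \<open>b = 0\<close> that term
      vanishes, but then \<open>a \<ge> 3\<close> makes index 1 strict.\<close>
    proof (cases "b = 0")
      case True
      have "P1 < Q1" unfolding P1_def Q1_def using assms 1 True by (intro moment_log_convex_strict) auto
      then show ?thesis using True assms by simp
    next
      case False
      have "P2 < Q2" unfolding P2_def Q2_def using assms False by (intro moment_log_convex_strict) auto
      then show ?thesis using False le1 by (intro add_le_less_mono) (auto intro: mult_left_mono)
    qed
    then show ?thesis unfolding 1 score_0 score_1 P1_def P2_def Q1_def Q2_def by (simp add: algebra_simps)
  next
    case 2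
    \<comment> \<open>The previous case with \<open>p \<theta>\<close> and
      \<open>1 - p \<theta>\<close> exchanged.\<close>
    define P1 Q1 P2 Q2 where "P1 = moment (b + 1) a * moment (a - 1) (b + 2)"
      and "Q1 = moment b (a + 1) * moment a (b + 1)"
      and "P2 = moment (b + 1) a * moment (a + 1) b"
      and "Q2 = moment b (a + 1) * moment (a + 2) (b - 1)"
    have le1: "P1 \<le> Q1" unfolding P1_def Q1_def using assms by (intro moment_log_convex) auto
    have "real a * P1 + real b * P2 < real a * Q1 + real b * Q2"
    proof (cases "b = 0")
      case True
      have "P1 < Q1" unfolding P1_def Q1_def using assms 2 True by (intro moment_log_convex_strict) auto
      then show ?thesis using True assms by simp
    next
      case False
      have "P2 < Q2" unfolding P2_def Q2_def using assms False by (intro moment_log_convex_strict) auto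
      then show ?thesis using False le1 by (intro add_le_less_mono) (auto intro: mult_left_mono)
    qed
    then show ?thesis unfolding 2 score_0 score_1 P1_def P2_def Q1_def Q2_def by (simp add: algebra_simps)
  next
    case 3
    \<comment> \<open>Indices 1 and 2 carry the squared coefficients, 3 and 4 the cross coefficient
      \<open>a * b\<close>. For \<open>b > 0\<close> the cross terms supply the strictness.\<close>
    define P1 Q1 P2 Q2 P3 Q3 P4 Q4
      where "P1 = moment (b + 2) (a - 1) * moment (a - 1) (b + 2)"
        and "Q1 = moment (b + 1) a * moment a (b + 1)"
        and "P2 = moment b (a + 1) * moment (a + 1) b"
        and "Q2 = moment (b - 1) (a + 2) * moment (a + 2) (b - 1)"
        and "P3 = moment (b + 2) (a - 1) * moment (a + 1) b"
        and "Q3 = moment (b + 1) a * moment (a + 2) (b - 1)"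
        and "P4 = moment b (a + 1) * moment (a - 1) (b + 2)"
        and "Q4 = moment (b - 1) (a + 2) * moment a (b + 1)"
    have "(real a)\<^sup>2 * P1 + (real b)\<^sup>2 * P2 + real a * real b * (P3 + P4) <
        (real a)\<^sup>2 * Q1 + (real b)\<^sup>2 * Q2 + real a * real b * (Q3 + Q4)"
    proof (cases "b = 0")
      case True
      have "P1 < Q1" unfolding P1_def Q1_def using assms 3 True by (intro moment_log_convex_strict) auto
      then show ?thesis using True assms by simp
    next
      case False
      have "P3 < Q3" unfolding P3_def Q3_def using assms False by (intro moment_log_convex_strict) auto
      moreover have "P4 \<le> Q4" unfolding P4_def Q4_def using assms False by (intro moment_log_convex) auto
      ultimately have cross: "real a * real b * (P3 + P4) < real a * real b * (Q3 + Q4)"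
        using False assms by simp
      have "(real a)\<^sup>2 * P1 + (real b)\<^sup>2 * P2 \<le> (real a)\<^sup>2 * Q1 + (real b)\<^sup>2 * Q2"
      proof (cases "a = b + 1")
        case True
        obtain i where i: "b = i + 1" using False by (cases b) auto
        \<comment> \<open>Since \<open>P1 = P2\<close> here, the goal is to bound
          \<open>a\<^sup>2 * (P2 - Q1)\<close> by \<open>b\<^sup>2 * (Q2 - P2)\<close>; the quartic
          inequality gives \<open>3 * (P2 - Q1) \<le> Q2 - P2\<close>.\<close>
        have "0 \<le> Q2 + 3 * Q1 - 4 * P2"
          using moment_quartic[of i i] unfolding P2_def Q1_def Q2_def True i
          by (simp add: numeral_eq_Suc)
        then have "(real b)\<^sup>2 * (3 * (P2 - Q1)) \<le> (real b)\<^sup>2 * (Q2 - P2)"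
          by (intro mult_left_mono) auto
        moreover have "P1 = P2" by (simp add: P1_def P2_def True mult.commute)
        moreover have "Q1 \<le> P2"
          unfolding P2_def Q1_def True by (intro moment_log_convex) auto
        moreover have "(real a)\<^sup>2 \<le> (real b)\<^sup>2 * 3"
        proof -
          \<comment> \<open>The bound \<open>a + b > 3\<close> enters here: for \<open>b = 1\<close>
            and \<open>a = 2\<close> the inequality would read \<open>4 \<le> 3\<close>.\<close>
          have "b \<ge> 2" using True assms 3 by linarith
          then have "0 \<le> (real b - 2) * (2 * real b + 2)" by (intro mult_nonneg_nonneg) auto
          then show ?thesis by (simp add: True power2_eq_square algebra_simps)
        qed
        then have "(real a)\<^sup>2 * (P2 - Q1) \<le> (real b)\<^sup>2 * 3 * (P2 - Q1)"
          using calculation(3) by (intro mult_right_mono) auto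
        ultimately show ?thesis by (simp add: algebra_simps)
      next
        case neq: False
        have "P1 \<le> Q1" unfolding P1_def Q1_def using assms neq by (intro moment_log_convex) auto
        moreover have "P2 \<le> Q2" unfolding P2_def Q2_def using assms False by (intro moment_log_convex) auto
        ultimately show ?thesis by (intro add_mono mult_left_mono) auto
      qed
      with cross show ?thesis by linarith
    qed
    then show ?thesis
      unfolding 3 score_0 P1_def P2_def P3_def P4_def Q1_def Q2_def Q3_def Q4_def
      by (simp add: algebra_simps power2_eq_square)
  qed
qed

subsection \<open>Equilibrium conditions at \<open>\<epsilon> = 0\<close>\<close>

lemma nash_score:
  fixes s :: "nat \<Rightarrow> strategy"
  assumes "N > 4" "nash_equilibrium N prior p (eps_payment N x y 0) s" "i < N"
  defines "n \<equiv> \<lambda>t. num_playing {..<N} s t - (if s i = t then 1 else 0)"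
  shows "s i sig \<Longrightarrow> x * score sig (n s_honest) (n s_lie) (n s_pos) \<le>
      y * score sig (n s_lie) (n s_honest) (n s_neg)"
    and "\<not> s i sig \<Longrightarrow> y * score sig (n s_lie) (n s_honest) (n s_neg) \<le>
      x * score sig (n s_honest) (n s_lie) (n s_pos)"
  using nash_eps_payment_0[OF finite_types p_bounds assms(1-3), of sig] assms(3)
  unfolding score_def n_def by (simp_all add: num_playing_remove)

lemma mult_le_mult_from_weighted:
  fixes x y :: real
  assumes "x > 0" "y > 0" "A \<ge> 0" "D \<ge> 0" "y * B \<le> x * A" "x * D \<le> y * C"
  shows "B * D \<le> A * C"
proof -
  have "(y * B) * (x * D) \<le> (x * A) * (y * C)"
    using assms by (intro mult_mono[OF assms(5,6)]) auto
  then have "(x * y) * (B * D) \<le> (x * y) * (A * C)" by (simp add: mult_ac)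
  with assms show ?thesis by simp
qed

lemma not_nash_at_0:
  assumes "N > 4" "x > 0" "y > 0" "profile_of_counts N n0 n1 nh nl s"
    and n: "n0 \<le> 1" "n1 \<le> 1" "n0 + n1 + nh + nl = N"
    and cases: "(nh \<noteq> 0 \<and> nl \<noteq> 0) \<or> (n0 = 1 \<and> n1 = 1)"
  shows "\<not> nash_equilibrium N prior p (eps_payment N x y 0) s"
proof
  assume nash: "nash_equilibrium N prior p (eps_payment N x y 0) s"
  have num: "num_playing {..<N} s s_honest = nh" "num_playing {..<N} s s_lie = nl"
    "num_playing {..<N} s s_pos = n1" "num_playing {..<N} s s_neg = n0"
    using assms(4) by (auto simp: profile_of_counts_def num_playing_def)
  have ex: "\<exists>i<N. s i = t" if "num_playing {..<N} s t \<noteq> 0" for t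
    using that unfolding num_playing_def by (auto simp: card_eq_0_iff)
  show False
  proof (cases "n0 = 1 \<and> n1 = 1")
    case True
    obtain i j where i: "i < N" "s i = s_pos" and j: "j < N" "s j = s_neg"
      using ex[of s_pos] ex[of s_neg] num True by auto
    \<comment> \<open>The opponents of \<open>i\<close> include no other agent playing
      \<open>s_pos\<close> but one playing \<open>s_neg\<close>; for \<open>j\<close> below it is
      the reverse.\<close>
    have pos: "x * score sig nh nl 0 \<le> y * score sig nl nh 1" for sig
      using nash_score(1)[OF assms(1) nash i(1), of sig] True by (simp add: i num) (simp add: s_pos_def)
    have neg: "y * score sig nl nh 0 \<le> x * score sig nh nl 1" for sig
      using nash_score(2)[OF assms(1) nash j(1), of sig] True by (simp add: j num) (simp add: s_neg_def)
    \<comment> \<open>Each of two positive quantities would be at least \<open>k \<ge> 2\<close>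
      times the other.\<close>
    have contradiction: False
      if "k \<ge> 2" "x * (real k * u) \<le> y * v" "y * (real k * v) \<le> x * u" "u > 0" for k :: nat and u v :: real
    proof -
      have "real k * (x * u) + real k * (y * v) \<le> x * u + y * v"
        using that by (simp add: mult_ac)
      then have "(real k - 1) * (x * u + y * v) \<le> 0"
        by (simp add: algebra_simps)
      moreover have "x * u > 0" "y * v > 0"
      proof -
        show "x * u > 0" using that assms by simp
        moreover have "x * (real k * u) > 0" using that assms by simp
        ultimately show "y * v > 0" using that by linarith
      qed
      ultimately show False
        using that by (simp add: mult_le_0_iff)
    qed
    consider "nh \<ge> 2" | "nl \<ge> 2" using n assms(1) True by linarith
    then show False
    proof cases
      case 1
      \<comment> \<open>Only the summand with coefficient \<open>nh\<close> is kept. Opposite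
        signals for the two agents make the same two moments appear in both conditions.\<close>
      have "x * (nh * moment (nl + 1) nh) \<le> x * score False nh nl 0"
        using assms by (simp add: score_0)
      also have "\<dots> \<le> y * moment nh (nl + 1)" using pos[of False] by (simp add: score_1[unfolded One_nat_def])
      finally have a: "x * (nh * moment (nl + 1) nh) \<le> y * moment nh (nl + 1)" .
      have "y * (nh * moment nh (nl + 1)) \<le> y * score True nl nh 0"
        using assms by (simp add: score_0)
      also have "\<dots> \<le> x * moment (nl + 1) nh" using neg[of True] by (simp add: score_1[unfolded One_nat_def])
      finally show False using contradiction[OF 1 a] moment_pos by blast
    next
      case 2
      have "x * (nl * moment nl (nh + 1)) \<le> x * score True nh nl 0"
        using assms by (simp add: score_0)
      also have "\<dots> \<le> y * moment (nh + 1) nl" using pos[of True] by (simp add: score_1[unfolded One_nat_def])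
      finally have a: "x * (nl * moment nl (nh + 1)) \<le> y * moment (nh + 1) nl" .
      have "y * (nl * moment (nh + 1) nl) \<le> y * score False nl nh 0"
        using assms by (simp add: score_0)
      also have "\<dots> \<le> x * moment nl (nh + 1)" using neg[of False] by (simp add: score_1[unfolded One_nat_def])
      finally show False using contradiction[OF 2 a] moment_pos by blast
    qed
  next
    case False
    with cases have nz: "nh \<noteq> 0" "nl \<noteq> 0" by auto
    then obtain i j where i: "i < N" "s i = s_honest" and j: "j < N" "s j = s_lie"
      using ex[of s_honest] ex[of s_lie] num by auto
    show False
    proof (cases "nl \<le> nh")
      case True
      \<comment> \<open>The liar faces \<open>nh\<close> honest agents and
        \<open>nl - 1 < nh\<close> liars, so \<open>score_mult_less\<close> applies with total
        \<open>N - 1 > 3\<close>.\<close>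
      have h: "y * score True (nl - 1) nh n0 \<le> x * score True nh (nl - 1) n1"
        "x * score False nh (nl - 1) n1 \<le> y * score False (nl - 1) nh n0"
        using nash_score(2)[OF assms(1) nash j(1), of True] nash_score(1)[OF assms(1) nash j(1), of False]
        by (simp_all add: j num) (simp_all add: s_lie_def)
      have "score True nh (nl - 1) n1 * score False (nl - 1) nh n0 <
          score False nh (nl - 1) n1 * score True (nl - 1) nh n0"
        by (rule score_mult_less) (use True False nz n assms(1) in linarith)+
      with mult_le_mult_from_weighted[OF assms(2,3) score_nonneg score_nonneg h] show False
        by (metis mult.commute leD)
    next
      case less: False
      \<comment> \<open>The mirror image: now \<open>nh - 1 < nl\<close>, and \<open>x\<close> with
        \<open>y\<close>, honest with lying, and \<open>n0\<close> with \<open>n1\<close> exchange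
        roles.\<close>
      have h: "x * score True (nh - 1) nl n1 \<le> y * score True nl (nh - 1) n0"
        "y * score False nl (nh - 1) n0 \<le> x * score False (nh - 1) nl n1"
        using nash_score(1)[OF assms(1) nash i(1), of True] nash_score(2)[OF assms(1) nash i(1), of False]
        by (simp_all add: i num) (simp_all add: s_honest_def)
      have "score True nl (nh - 1) n0 * score False (nh - 1) nl n1 <
          score False nl (nh - 1) n0 * score True (nh - 1) nl n1"
        by (rule score_mult_less) (use less False nz n assms(1) in linarith)+
      with mult_le_mult_from_weighted[OF assms(3,2) score_nonneg score_nonneg h] show False
        by (metis mult.commute leD)
    qed
  qed
qed

end

theorem proposition4p6:
  fixes \<Theta> :: "'a set" and prior :: "'a pmf" and p :: "'a \<Rightarrow> real"
    and N :: nat and x y :: real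
  assumes "finite \<Theta>" and "card \<Theta> \<ge> 2"
    and "set_pmf prior = \<Theta>"
    and "\<forall>\<theta>\<in>\<Theta>. 0 < p \<theta> \<and> p \<theta> < 1"
    and "\<forall>\<theta>1\<in>\<Theta>. \<forall>\<theta>2\<in>\<Theta>. \<theta>1 \<noteq> \<theta>2 \<longrightarrow> p \<theta>1 \<noteq> p \<theta>2"
    and "N > 4" and "x > 0" and "y > 0"
  shows "\<forall>\<^sub>F \<epsilon> in at_right 0.
           \<forall>n0 n1 nh nl s.
             n0 \<in> {0, 1} \<and> n1 \<in> {0, 1} \<and> nh \<notin> {N - 1, N} \<and> n0 + n1 + nh + nl = N \<and>
             profile_of_counts N n0 n1 nh nl s \<and>
             ((nh \<noteq> 0 \<and> nl \<noteq> 0) \<or> (n0 = 1 \<and> n1 = 1))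
             \<longrightarrow> \<not> nash_equilibrium N prior p (eps_payment N x y \<epsilon>) s"
proof -
  obtain \<theta> \<theta>' where "\<theta> \<in> \<Theta>" "\<theta>' \<in> \<Theta>" "\<theta> \<noteq> \<theta>'"
    using assms(2) by (auto simp: card_le_Suc_iff numeral_2_eq_2)
  then interpret binary_types prior p
    using assms by unfold_locales blast+
  have "\<forall>\<^sub>F \<epsilon> in at_right 0. \<forall>s. \<not> nash_equilibrium N prior p (eps_payment N x y 0) s \<longrightarrow>
      \<not> nash_equilibrium N prior p (eps_payment N x y \<epsilon>) s"
    by (rule eventually_not_nash_equilibrium[OF finite_types p_bounds])
  then show ?thesis
  proof eventually_elim
    case (elim \<epsilon>)
    have "\<not> nash_equilibrium N prior p (eps_payment N x y 0) s"
      if "n0 \<in> {0, 1}" "n1 \<in> {0, 1}" "n0 + n1 + nh + nl = N" "profile_of_counts N n0 n1 nh nl s"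
        "(nh \<noteq> 0 \<and> nl \<noteq> 0) \<or> (n0 = 1 \<and> n1 = 1)" for n0 n1 nh nl s
      using that assms by (intro not_nash_at_0[where ?n0.0 = n0 and ?n1.0 = n1 and nh = nh and nl = nl]) auto
    with elim show ?case by blast
  qed
qed

end
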